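(* There exists an instance of the unconstrained submodular maximization problem $\max_{S\subseteq X} f(S)$ (with $f$ a nonnegative submodular function, in fact the cut function of a directed graph) such that the approximation factor of Algorithm 1 (described in the context) on this instance is $17/35<0.486$.
   Context: $f:2^X\to\mathbb{R}_+$ is submodular: $f(S\cup T)+f(S\cap T)\le f(S)+f(T)$. Let $n=|X|$ and $F(\mathbf{x})=\sum_{S\subseteq X} f(S)\prod_{i\in S}x_i\prod_{j\notin S}(1-x_j)$ the multilinear extension. For $A\subseteq X$, $\mathbf{x}_p(A)=p\mathbf{1}_A+(1-p)\mathbf{1}_{X\setminus A}$. Algorithm 1: set $\delta=1/n^3$, $A\leftarrow\emptyset$. For $p=\tfrac12,\tfrac12+\delta,\dots$ as long as $p<1$: while there exists $i\in X$ with $F(\mathbf{x}_p(A\triangle\{i\}))>F(\mathbf{x}_p(A))$, replace $A$ by $A\triangle\{i\}$. Return the set of largest $f$-value among all sets $A$ and complements $X\setminus A$ encountered. (The choice of which improving $i$ to flip is arbitrary.) The approximation factor on an instance is the ratio of the returned value to $\max_S f(S)$. *)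

theory Defs
  imports Complex_Main "HOL-Library.Indicator_Function" "Graph_Theory.Digraph"
begin

definition submodular_on :: "'a set \<Rightarrow> ('a set \<Rightarrow> real) \<Rightarrow> bool" where
  "submodular_on X f \<longleftrightarrow>
     (\<forall>S T. S \<subseteq> X \<longrightarrow> T \<subseteq> X \<longrightarrow> f (S \<union> T) + f (S \<inter> T) \<le> f S + f T)"

text \<open>Parallel arcs are counted with multiplicity.\<close>

definition dicut :: "('a, 'b) pre_digraph \<Rightarrow> 'a set \<Rightarrow> real" where
  "dicut G S = real (card {a \<in> arcs G. tail G a \<in> S \<and> head G a \<notin> S})"

definition multilinear_ext :: "'a set \<Rightarrow> ('a set \<Rightarrow> real) \<Rightarrow> ('a \<Rightarrow> real) \<Rightarrow> real" where
  "multilinear_ext X f x = (\<Sum>S\<in>Pow X. f S * (\<Prod>i\<in>S. x i) * (\<Prod>j\<in>X - S. 1 - x j))"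

definition biased_point :: "'a set \<Rightarrow> real \<Rightarrow> 'a set \<Rightarrow> 'a \<Rightarrow> real" where
  "biased_point X p A = (\<lambda>i. p * indicator A i + (1 - p) * indicator (X - A) i)"

definition biased_value :: "'a set \<Rightarrow> ('a set \<Rightarrow> real) \<Rightarrow> real \<Rightarrow> 'a set \<Rightarrow> real" where
  "biased_value X f p A = multilinear_ext X f (biased_point X p A)"

definition alg_prob :: "'a set \<Rightarrow> nat \<Rightarrow> real" where
  "alg_prob X k = 1 / 2 + real k * (1 / real (card X) ^ 3)"

text \<open>
  \<^term>\<open>alg_reach X f k A E\<close>: some execution on the instance \<^term>\<open>(X, f)\<close> is in round \<^term>\<open>k\<close>
  of the outer loop (the round with \<^term>\<open>p = alg_prob X k\<close>) with current set \<^term>\<open>A\<close>, the sets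
  held so far being those in \<^term>\<open>E\<close>. The relation is nondeterministic in the improving
  element that is flipped.
\<close>

inductive alg_reach ::
  "'a set \<Rightarrow> ('a set \<Rightarrow> real) \<Rightarrow> nat \<Rightarrow> 'a set \<Rightarrow> 'a set set \<Rightarrow> bool"
  for X :: "'a set" and f :: "'a set \<Rightarrow> real"
where
  init: "alg_reach X f 0 {} {{}}"
| flip: "\<lbrakk>alg_reach X f k A E; alg_prob X k < 1; i \<in> X;
          biased_value X f (alg_prob X k) (sym_diff A {i}) > biased_value X f (alg_prob X k) A\<rbrakk>
         \<Longrightarrow> alg_reach X f k (sym_diff A {i}) (insert (sym_diff A {i}) E)"
| next_round: "\<lbrakk>alg_reach X f k A E; alg_prob X k < 1;
          \<not> (\<exists>i\<in>X. biased_value X f (alg_prob X k) (sym_diff A {i})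
                 > biased_value X f (alg_prob X k) A)\<rbrakk>
         \<Longrightarrow> alg_reach X f (Suc k) A E"

definition alg_returns :: "'a set \<Rightarrow> ('a set \<Rightarrow> real) \<Rightarrow> 'a set \<Rightarrow> bool" where
  "alg_returns X f R \<longleftrightarrow>
     (\<exists>k A E. alg_reach X f k A E \<and> \<not> alg_prob X k < 1 \<and>
        R \<in> E \<union> (\<lambda>S. X - S) ` E \<and> (\<forall>S \<in> E \<union> (\<lambda>S. X - S) ` E. f S \<le> f R))"

text \<open>
  Since the flipped element may be chosen arbitrarily, the factor achieved on an instance is the
  worst one over all executions.
\<close>

definition approximation_factor :: "'a set \<Rightarrow> ('a set \<Rightarrow> real) \<Rightarrow> real" where
  "approximation_factor X f = Min {f R / Max (f ` Pow X) | R. alg_returns X f R}"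

end

theory Submission
  imports Defs "HOL-Library.Nat_Bijection"
begin

text \<open>
  For a directed cut function, flipping \<^term>\<open>i\<close> at \<^term>\<open>p > 1 / 2\<close> improves the value exactly when
  a quantity affine in \<^term>\<open>p\<close>, the partial derivative of the multilinear extension at \<^term>\<open>i\<close>, has
  the right sign; hence stability of a set on an interval of values of \<^term>\<open>p\<close> need only be checked
  at its ends.

  On the instance below the optimum is attained at \<open>{0, 2, 4, 7}\<close> with value 1400. One execution moves
  to \<open>{0, 1, 4, 6}\<close> as soon as \<^term>\<open>p > 1 / 2\<close>, stays there until \<^term>\<open>p\<close> exceeds about 0.835, then
  slides through sets of slowly growing value to \<open>{0, 1, 5, 7}\<close> and remains there; the best value it
  meets is 680. No execution does worse: the final set is locally optimal for the last value
  \<open>p = 511 / 512\<close> of the outer loop, and every such set has cut value at least 680.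
\<close>

section \<open>Directed cut functions\<close>

lemma dicut_eq_sum:
  assumes "finite (arcs G)"
  shows "dicut G S = (\<Sum>a\<in>arcs G. of_bool (tail G a \<in> S \<and> head G a \<notin> S))"
proof -
  have "{a \<in> arcs G. tail G a \<in> S \<and> head G a \<notin> S} = arcs G \<inter> {a. tail G a \<in> S \<and> head G a \<notin> S}"
    by blast
  with assms show ?thesis
    by (simp add: dicut_def of_bool_def sum.If_cases)
qed

text \<open>The cut indicator of a single arc is already submodular, so the inequality holds term by
  term.\<close>

lemma submodular_on_dicut:
  assumes "finite (arcs G)"
  shows "submodular_on X (dicut G)"
  unfolding submodular_on_def dicut_eq_sum[OF assms] sum.distrib[symmetric]
  by (intro allI impI sum_mono) auto

lemma sum_Pow_prod_of_bool:
  fixes x :: "'a \<Rightarrow> real"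
  assumes "finite X" "u \<in> X" "v \<in> X" "u \<noteq> v"
  shows "(\<Sum>S\<in>Pow X. of_bool (u \<in> S \<and> v \<notin> S) * (\<Prod>i\<in>S. x i) * (\<Prod>j\<in>X - S. 1 - x j))
       = x u * (1 - x v)"
proof -
  \<comment> \<open>Zeroing the factor of \<^term>\<open>v\<close> inside and of \<^term>\<open>u\<close> outside \<^term>\<open>S\<close> absorbs the cut condition,
    after which the sum is an expanded product.\<close>
  define g where "g i = (if i = v then 0 else x i)" for i
  define h where "h i = (if i = u then 0 else 1 - x i)" for i
  have "of_bool (u \<in> S \<and> v \<notin> S) * (\<Prod>i\<in>S. x i) * (\<Prod>j\<in>X - S. 1 - x j)
        = (\<Prod>i\<in>S. g i) * (\<Prod>j\<in>X - S. h j)" if "S \<in> Pow X" for S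
  proof (cases "u \<in> S \<and> v \<notin> S")
    case True
    then have "(\<Prod>i\<in>S. g i) = (\<Prod>i\<in>S. x i)" "(\<Prod>j\<in>X - S. h j) = (\<Prod>j\<in>X - S. 1 - x j)"
      by (auto intro!: prod.cong simp: g_def h_def)
    with True show ?thesis by simp
  next
    case False
    have fin: "finite S" using that assms(1) by (auto intro: finite_subset)
    from False consider "v \<in> S" | "u \<in> X - S" using assms(2) by blast
    then have "(\<Prod>i\<in>S. g i) * (\<Prod>j\<in>X - S. h j) = 0"
      by cases (use fin assms(1) in \<open>auto simp: g_def h_def\<close>)
    moreover have "of_bool (u \<in> S \<and> v \<notin> S) = (0::real)" using False by simp
    ultimately show ?thesis by (simp only: mult_zero_left)
  qed
  then have "(\<Sum>S\<in>Pow X. of_bool (u \<in> S \<and> v \<notin> S) * (\<Prod>i\<in>S. x i) * (\<Prod>j\<in>X - S. 1 - x j))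
      = (\<Sum>S\<in>Pow X. (\<Prod>i\<in>S. g i) * (\<Prod>j\<in>X - S. h j))"
    by (rule sum.cong[OF refl])
  also have "\<dots> = (\<Prod>i\<in>X. g i + h i)"
    by (rule prod_add[symmetric]) fact
  \<comment> \<open>Every factor other than those of \<open>u\<close> and \<open>v\<close> is
    \<open>x i + (1 - x i) = 1\<close>.\<close>
  also have "\<dots> = (\<Prod>i\<in>{u, v}. g i + h i)"
    using assms by (intro prod.mono_neutral_right) (auto simp: g_def h_def)
  also have "\<dots> = x u * (1 - x v)"
    using assms(4) by (simp add: g_def h_def)
  finally show ?thesis .
qed

text \<open>Sampling each \<open>i\<close> independently with probability \<open>x i\<close>, an arc
  is cut with the product of the probabilities that its tail is in and its head is out. A loop would
  break this independence.\<close>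

lemma multilinear_ext_dicut:
  assumes "fin_digraph G" "loopfree_digraph G"
  shows "multilinear_ext (verts G) (dicut G) x = (\<Sum>a\<in>arcs G. x (tail G a) * (1 - x (head G a)))"
proof -
  interpret fin_digraph G by fact
  interpret loopfree_digraph G by fact
  have "multilinear_ext (verts G) (dicut G) x
      = (\<Sum>a\<in>arcs G. \<Sum>S\<in>Pow (verts G). of_bool (tail G a \<in> S \<and> head G a \<notin> S)
            * (\<Prod>i\<in>S. x i) * (\<Prod>j\<in>verts G - S. 1 - x j))"
    unfolding multilinear_ext_def dicut_eq_sum[OF finite_arcs] sum_distrib_right
    by (rule sum.swap)
  also have "\<dots> = (\<Sum>a\<in>arcs G. x (tail G a) * (1 - x (head G a)))"
    by (intro sum.cong refl sum_Pow_prod_of_bool) (auto simp: no_loops)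
  finally show ?thesis .
qed

section \<open>Flip gains\<close>

text \<open>Agrees with \<open>biased_point\<close> on the ground set only; outside it the latter is
  0.\<close>

definition side :: "real \<Rightarrow> 'a set \<Rightarrow> 'a \<Rightarrow> real" where
  "side p A i = (if i \<in> A then p else 1 - p)"

definition gain :: "('a, 'b) pre_digraph \<Rightarrow> real \<Rightarrow> 'a set \<Rightarrow> 'a \<Rightarrow> real" where
  "gain G p A i = (\<Sum>a\<in>arcs G. of_bool (tail G a = i) * (1 - side p A (head G a))
                              - of_bool (head G a = i) * side p A (tail G a))"

lemma biased_value_dicut:
  assumes "fin_digraph G" "loopfree_digraph G"
  shows "biased_value (verts G) (dicut G) p A
       = (\<Sum>a\<in>arcs G. side p A (tail G a) * (1 - side p A (head G a)))"
proof -
  interpret fin_digraph G by fact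
  have "biased_point (verts G) p A i = side p A i" if "i \<in> verts G" for i
    using that by (auto simp: biased_point_def side_def indicator_def)
  then show ?thesis
    unfolding biased_value_def multilinear_ext_dicut[OF assms] by (intro sum.cong refl) simp
qed

text \<open>Without loops the arc sum is affine in coordinate \<open>i\<close> with slope
  \<open>gain\<close>, and the flip moves that coordinate from \<open>s\<close> to
  \<open>1 - s\<close>.\<close>

lemma biased_value_flip_diff:
  assumes "fin_digraph G" "loopfree_digraph G"
  shows "biased_value (verts G) (dicut G) p (sym_diff A {i}) - biased_value (verts G) (dicut G) p A
       = (1 - 2 * side p A i) * gain G p A i"
proof -
  interpret loopfree_digraph G by fact
  have flip: "side p (sym_diff A {i}) j = (if j = i then 1 - side p A i else side p A j)" for j
    by (auto simp: side_def)
  show ?thesis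
    unfolding biased_value_dicut[OF assms] gain_def sum_subtractf[symmetric] sum_distrib_left
  proof (intro sum.cong refl)
    fix a assume "a \<in> arcs G"
    then have "tail G a \<noteq> head G a" by (rule no_loops)
    then show "side p (sym_diff A {i}) (tail G a) * (1 - side p (sym_diff A {i}) (head G a))
        - side p A (tail G a) * (1 - side p A (head G a))
      = (1 - 2 * side p A i) * (of_bool (tail G a = i) * (1 - side p A (head G a))
          - of_bool (head G a = i) * side p A (tail G a))"
      unfolding flip by (auto simp: algebra_simps)
  qed
qed

lemma flip_improves_iff:
  assumes "fin_digraph G" "loopfree_digraph G" "1 / 2 < p"
  shows "biased_value (verts G) (dicut G) p A < biased_value (verts G) (dicut G) p (sym_diff A {i})
     \<longleftrightarrow> (if i \<in> A then gain G p A i < 0 else 0 < gain G p A i)"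
proof -
  have "biased_value (verts G) (dicut G) p A < biased_value (verts G) (dicut G) p (sym_diff A {i})
     \<longleftrightarrow> 0 < (1 - 2 * side p A i) * gain G p A i"
    unfolding biased_value_flip_diff[OF assms(1,2), symmetric] by simp
  then show ?thesis
    using assms(3) by (auto simp: side_def zero_less_mult_iff)
qed

text \<open>At bias 1/2 all sets give the same point, so round 0 passes without a flip.\<close>

lemma no_improving_flip_at_half:
  assumes "fin_digraph G" "loopfree_digraph G"
  shows "\<not> biased_value (verts G) (dicut G) (1 / 2) A
           < biased_value (verts G) (dicut G) (1 / 2) (sym_diff A {i})"
proof -
  have "1 - 2 * side (1 / 2) A i = 0" by (simp add: side_def)
  then show ?thesis
    using biased_value_flip_diff[OF assms, of "1 / 2" A i] by simp
qed

section \<open>Executions\<close>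

definition local_opt :: "'a set \<Rightarrow> ('a set \<Rightarrow> real) \<Rightarrow> real \<Rightarrow> 'a set \<Rightarrow> bool" where
  "local_opt X f p A \<longleftrightarrow> \<not> (\<exists>i\<in>X. biased_value X f p (sym_diff A {i}) > biased_value X f p A)"

lemma alg_reach_sets:
  assumes "alg_reach X f k A E"
  shows "A \<in> E \<and> E \<subseteq> Pow X"
  using assms by induction auto

text \<open>\<open>init\<close> has bias 1/2 and \<open>flip\<close> requires bias below 1, so only
  \<open>next_round\<close> can enter a terminal round.\<close>

lemma alg_reach_terminal:
  assumes "alg_reach X f k A E" "\<not> alg_prob X k < 1"
  obtains j where "k = Suc j" "alg_prob X j < 1" "local_opt X f (alg_prob X j) A"
  using assms by cases (auto simp: alg_prob_def local_opt_def)

text \<open>Crosses a whole block of rounds at once, which avoids stepping through them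
  singly.\<close>

lemma alg_reach_stable:
  assumes "alg_reach X f k A E" "k \<le> m"
    and "\<And>j. k \<le> j \<Longrightarrow> j < m \<Longrightarrow> alg_prob X j < 1 \<and> local_opt X f (alg_prob X j) A"
  shows "alg_reach X f m A E"
  using assms(2,1,3)
proof (induction m rule: dec_induct)
  case (step m)
  then have "alg_reach X f m A E" by simp
  moreover have "alg_prob X m < 1" "local_opt X f (alg_prob X m) A"
    using step.hyps step.prems(2) by auto
  ultimately show ?case
    by (intro next_round) (auto simp: local_opt_def)
qed

section \<open>Digraphs from lists of weighted arcs\<close>

text \<open>Arc \<open>prod_encode (i, j)\<close> is the \<open>j\<close>-th parallel copy of list
  entry \<open>i\<close>: weights become multiplicities, which \<open>dicut\<close> counts.\<close>

definition list_digraph :: "'a set \<Rightarrow> ('a \<times> 'a \<times> nat) list \<Rightarrow> ('a, nat) pre_digraph" where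
  "list_digraph V ws = \<lparr>verts = V,
     arcs = prod_encode ` (SIGMA i:{..<length ws}. {..<snd (snd (ws ! i))}),
     tail = (\<lambda>a. fst (ws ! fst (prod_decode a))),
     head = (\<lambda>a. fst (snd (ws ! fst (prod_decode a))))\<rparr>"

lemma verts_list_digraph [simp]: "verts (list_digraph V ws) = V"
  by (simp add: list_digraph_def)

lemma sum_arcs_list_digraph:
  fixes g :: "'a \<Rightarrow> 'a \<Rightarrow> real"
  shows "(\<Sum>a\<in>arcs (list_digraph V ws). g (tail (list_digraph V ws) a) (head (list_digraph V ws) a))
       = (\<Sum>(u, v, c)\<leftarrow>ws. real c * g u v)"
proof -
  have "(\<Sum>a\<in>arcs (list_digraph V ws). g (tail (list_digraph V ws) a) (head (list_digraph V ws) a))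
      = (\<Sum>(i, j)\<in>(SIGMA i:{..<length ws}. {..<snd (snd (ws ! i))}).
            g (fst (ws ! i)) (fst (snd (ws ! i))))"
    by (simp add: list_digraph_def sum.reindex inj_prod_encode case_prod_beta)
  also have "\<dots> = (\<Sum>i<length ws. real (snd (snd (ws ! i))) * g (fst (ws ! i)) (fst (snd (ws ! i))))"
    by (simp add: sum.Sigma[symmetric])
  also have "\<dots> = (\<Sum>(u, v, c)\<leftarrow>ws. real c * g u v)"
    by (simp add: sum_list_sum_nth atLeast0LessThan case_prod_beta)
  finally show ?thesis .
qed

lemma arcs_list_digraphE:
  assumes "a \<in> arcs (list_digraph V ws)"
  obtains c where "(tail (list_digraph V ws) a, head (list_digraph V ws) a, c) \<in> set ws"
proof -
  from assms obtain i j where "i < length ws" "a = prod_encode (i, j)"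
    by (auto simp: list_digraph_def)
  then have "(tail (list_digraph V ws) a, head (list_digraph V ws) a, snd (snd (ws ! i))) \<in> set ws"
    by (simp add: list_digraph_def)
  then show thesis by (rule that)
qed

lemma fin_digraph_list_digraph:
  assumes "finite V" "\<And>u v c. (u, v, c) \<in> set ws \<Longrightarrow> u \<in> V \<and> v \<in> V"
  shows "fin_digraph (list_digraph V ws)"
proof
  show "finite (arcs (list_digraph V ws))" by (simp add: list_digraph_def)
qed (use assms in \<open>auto elim!: arcs_list_digraphE\<close>)

lemma loopfree_digraph_list_digraph:
  assumes "\<And>u v c. (u, v, c) \<in> set ws \<Longrightarrow> u \<in> V \<and> v \<in> V \<and> u \<noteq> v"
  shows "loopfree_digraph (list_digraph V ws)"
  by standard (use assms in \<open>auto elim!: arcs_list_digraphE\<close>)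

section \<open>The hard instance\<close>

text \<open>
  The weights are a rounded solution of the linear program that maximises the cut at \<open>{0, 2, 4, 7}\<close>
  subject to the local optimality and improvement conditions of the execution described above.
\<close>

definition hard_arcs :: "(nat \<times> nat \<times> nat) list" where
  "hard_arcs =
    [(0, 1, 439), (0, 6, 109), (1, 0, 109), (1, 2, 422), (1, 4, 19), (1, 7, 107), (2, 1, 120),
     (2, 3, 440), (2, 5, 91), (3, 2, 108), (4, 1, 91), (4, 5, 1), (5, 2, 19), (5, 6, 3),
     (6, 2, 109), (6, 5, 1), (6, 7, 2), (7, 1, 1), (7, 3, 108)]"

definition hard_graph :: "(nat, nat) pre_digraph" where
  "hard_graph = list_digraph {..<8} hard_arcs"

lemma verts_hard_graph [simp]: "verts hard_graph = {..<8}"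
  by (simp add: hard_graph_def)

lemma fin_digraph_hard_graph: "fin_digraph hard_graph"
  unfolding hard_graph_def by (rule fin_digraph_list_digraph) (auto simp: hard_arcs_def)

lemma loopfree_digraph_hard_graph: "loopfree_digraph hard_graph"
  unfolding hard_graph_def by (rule loopfree_digraph_list_digraph) (auto simp: hard_arcs_def)

lemma dicut_hard_graph:
  "dicut hard_graph S = (\<Sum>(u, v, c)\<leftarrow>hard_arcs. real c * of_bool (u \<in> S \<and> v \<notin> S))"
  unfolding dicut_eq_sum[OF fin_digraph.finite_arcs[OF fin_digraph_hard_graph]]
  unfolding hard_graph_def by (rule sum_arcs_list_digraph)

lemma dicut_hard_graph_value:
  "dicut hard_graph S =
     (if 0 \<in> S \<and> 1 \<notin> S then 439 else 0) + (if 0 \<in> S \<and> 6 \<notin> S then 109 else 0)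
   + (if 1 \<in> S \<and> 0 \<notin> S then 109 else 0) + (if 1 \<in> S \<and> 2 \<notin> S then 422 else 0)
   + (if 1 \<in> S \<and> 4 \<notin> S then 19 else 0) + (if 1 \<in> S \<and> 7 \<notin> S then 107 else 0)
   + (if 2 \<in> S \<and> 1 \<notin> S then 120 else 0) + (if 2 \<in> S \<and> 3 \<notin> S then 440 else 0)
   + (if 2 \<in> S \<and> 5 \<notin> S then 91 else 0) + (if 3 \<in> S \<and> 2 \<notin> S then 108 else 0)
   + (if 4 \<in> S \<and> 1 \<notin> S then 91 else 0) + (if 4 \<in> S \<and> 5 \<notin> S then 1 else 0)
   + (if 5 \<in> S \<and> 2 \<notin> S then 19 else 0) + (if 5 \<in> S \<and> 6 \<notin> S then 3 else 0)
   + (if 6 \<in> S \<and> 2 \<notin> S then 109 else 0) + (if 6 \<in> S \<and> 5 \<notin> S then 1 else 0)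
   + (if 6 \<in> S \<and> 7 \<notin> S then 2 else 0) + (if 7 \<in> S \<and> 1 \<notin> S then 1 else 0)
   + (if 7 \<in> S \<and> 3 \<notin> S then 108 else 0)"
  by (simp add: dicut_hard_graph hard_arcs_def of_bool_def)

lemma gain_hard_graph:
  "gain hard_graph p A i = (\<Sum>(u, v, c)\<leftarrow>hard_arcs.
     real c * (of_bool (u = i) * (1 - side p A v) - of_bool (v = i) * side p A u))"
  unfolding gain_def hard_graph_def by (rule sum_arcs_list_digraph)

lemma gain_hard_graph_values:
  "gain hard_graph p A 0 = 548 - 548 * side p A 1 - 109 * side p A 6"
  "gain hard_graph p A 1 = 657 - 548 * side p A 0 - 542 * side p A 2 - 110 * side p A 4 - 108 * side p A 7"
  "gain hard_graph p A 2 = 651 - 542 * side p A 1 - 548 * side p A 3 - 110 * side p A 5 - 109 * side p A 6"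
  "gain hard_graph p A 3 = 108 - 548 * side p A 2 - 108 * side p A 7"
  "gain hard_graph p A 4 = 92 - 110 * side p A 1 - side p A 5"
  "gain hard_graph p A 5 = 22 - 110 * side p A 2 - side p A 4 - 4 * side p A 6"
  "gain hard_graph p A 6 = 112 - 109 * side p A 0 - 109 * side p A 2 - 4 * side p A 5 - 2 * side p A 7"
  "gain hard_graph p A 7 = 109 - 108 * side p A 1 - 108 * side p A 3 - 2 * side p A 6"
  by (simp_all add: gain_hard_graph hard_arcs_def algebra_simps)

lemma improves_hard_graph_iff:
  assumes "1 / 2 < p"
  shows "biased_value {..<8} (dicut hard_graph) p A
       < biased_value {..<8} (dicut hard_graph) p (sym_diff A {i})
     \<longleftrightarrow> (if i \<in> A then gain hard_graph p A i < 0 else 0 < gain hard_graph p A i)"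
  using flip_improves_iff[OF fin_digraph_hard_graph loopfree_digraph_hard_graph assms] by simp

lemma local_opt_hard_graph_iff:
  assumes "1 / 2 < p"
  shows "local_opt {..<8} (dicut hard_graph) p A \<longleftrightarrow>
    (\<forall>i<8. if i \<in> A then 0 \<le> gain hard_graph p A i else gain hard_graph p A i \<le> 0)"
  unfolding local_opt_def improves_hard_graph_iff[OF assms] by (auto simp: not_less)

lemma all_less_8_iff:
  "(\<forall>i<8. P i) \<longleftrightarrow> P 0 \<and> P 1 \<and> P 2 \<and> P 3 \<and> P 4 \<and> P 5 \<and> P 6 \<and> P (7::nat)"
  by (simp add: numeral_eq_Suc All_less_Suc2)

section \<open>Maximum cut, and cut values of the local optima at the final bias\<close>

lemma dicut_hard_graph_le: "dicut hard_graph S \<le> 1400"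
  unfolding dicut_hard_graph_value
  by (cases "0 \<in> S"; cases "1 \<in> S"; cases "2 \<in> S"; cases "3 \<in> S"; cases "4 \<in> S";
      cases "5 \<in> S"; cases "6 \<in> S"; cases "7 \<in> S"; simp)

lemma Max_dicut_hard_graph: "Max (dicut hard_graph ` Pow {..<8}) = 1400"
proof (rule Max_eqI)
  show "1400 \<in> dicut hard_graph ` Pow {..<8}"
    by (rule image_eqI[where x = "{0, 2, 4, 7}"]) (auto simp: dicut_hard_graph_value)
qed (auto simp: dicut_hard_graph_le)

lemma local_opt_hard_graph_ge:
  assumes "local_opt {..<8} (dicut hard_graph) (511 / 512) A"
  shows "680 \<le> dicut hard_graph A"
proof -
  let ?p = "511 / 512 :: real"
  have "\<forall>i<8. if i \<in> A then 0 \<le> gain hard_graph ?p A i else gain hard_graph ?p A i \<le> 0"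
    using assms by (subst (asm) local_opt_hard_graph_iff) simp_all
  then have opt: "if 0 \<in> A then 0 \<le> gain hard_graph ?p A 0 else gain hard_graph ?p A 0 \<le> 0"
    "if 1 \<in> A then 0 \<le> gain hard_graph ?p A 1 else gain hard_graph ?p A 1 \<le> 0"
    "if 2 \<in> A then 0 \<le> gain hard_graph ?p A 2 else gain hard_graph ?p A 2 \<le> 0"
    "if 3 \<in> A then 0 \<le> gain hard_graph ?p A 3 else gain hard_graph ?p A 3 \<le> 0"
    "if 4 \<in> A then 0 \<le> gain hard_graph ?p A 4 else gain hard_graph ?p A 4 \<le> 0"
    "if 5 \<in> A then 0 \<le> gain hard_graph ?p A 5 else gain hard_graph ?p A 5 \<le> 0"
    "if 6 \<in> A then 0 \<le> gain hard_graph ?p A 6 else gain hard_graph ?p A 6 \<le> 0"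
    "if 7 \<in> A then 0 \<le> gain hard_graph ?p A 7 else gain hard_graph ?p A 7 \<le> 0"
    unfolding all_less_8_iff by blast+
  note opt = opt[unfolded gain_hard_graph_values side_def]
  \<comment> \<open>With \<open>p\<close> this close to 1 the signs of four gains are forced, so 4,
    5, 0 and 3 are determined by 1, 2, 6 and 7; only 16 cases remain.\<close>
  have "4 \<in> A \<longleftrightarrow> 1 \<notin> A"
    using opt(5) by (simp split: if_splits)
  moreover have "5 \<in> A \<longleftrightarrow> 2 \<notin> A"
    using opt(6) by (simp split: if_splits)
  moreover have "0 \<in> A \<longleftrightarrow> 1 \<notin> A \<or> 6 \<notin> A"
    using opt(1) by (simp split: if_splits)
  moreover have "3 \<in> A \<longleftrightarrow> 2 \<notin> A \<and> 7 \<notin> A"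
    using opt(4) by (simp split: if_splits)
  ultimately show ?thesis
    using opt(2,3,7,8) unfolding dicut_hard_graph_value
    by (cases "1 \<in> A"; cases "2 \<in> A"; cases "6 \<in> A"; cases "7 \<in> A"; simp)
qed

section \<open>A worst execution: rounds 0 to 255, with bias step 1/512\<close>

lemma alg_prob_8 [simp]: "alg_prob {..<8::nat} k = 1 / 2 + real k / 512"
  by (simp add: alg_prob_def)

lemma flip_hard_graph:
  assumes "alg_reach {..<8} (dicut hard_graph) k A E" "0 < k" "k < 256" "i < 8"
    and "if i \<in> A then gain hard_graph (1 / 2 + real k / 512) A i < 0
         else 0 < gain hard_graph (1 / 2 + real k / 512) A i"
    and "B = sym_diff A {i}"
  shows "alg_reach {..<8} (dicut hard_graph) k B (insert B E)"
proof -
  have "1 / 2 < 1 / 2 + real k / 512" using assms(2) by simp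
  from improves_hard_graph_iff[OF this, of A i] assms show ?thesis
    unfolding assms(6) by (intro flip) auto
qed

text \<open>The tightest condition is that of vertex 0, \<open>548 - 657 * p \<ge> 0\<close>; its
  root, about 0.8341, lies just above 427/512, so round 171 is the last stable one.\<close>

lemma local_opt_early:
  assumes "1 / 2 < p" "p \<le> 1 / 2 + 171 / 512"
  shows "local_opt {..<8} (dicut hard_graph) p {0, 1, 4, 6}"
  using assms unfolding local_opt_hard_graph_iff[OF assms(1)] all_less_8_iff gain_hard_graph_values
  by (simp add: side_def)

text \<open>The upper end is sharp: the gains at 0 and 3 are \<open>439 * (1 - p)\<close> and
  \<open>440 * (p - 1)\<close>.\<close>

lemma local_opt_late:
  assumes "1 / 2 + 172 / 512 \<le> p" "p \<le> 1"
  shows "local_opt {..<8} (dicut hard_graph) p {0, 1, 5, 7}"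
proof -
  have half: "1 / 2 < p" using assms(1) by simp
  show ?thesis
    using assms unfolding local_opt_hard_graph_iff[OF half] all_less_8_iff gain_hard_graph_values
    by (simp add: side_def)
qed

definition worst_sets :: "nat set set" where
  "worst_sets =
     {{0, 1, 5, 7}, {0, 1, 5}, {0, 1, 5, 6}, {0, 1, 6}, {0, 1, 4, 6}, {0, 1, 4}, {0, 4}, {4}, {}}"

lemma worst_execution: "alg_reach {..<8} (dicut hard_graph) 256 {0, 1, 5, 7} worst_sets"
proof -
  let ?reach = "alg_reach {..<8} (dicut hard_graph)"
  \<comment> \<open>The simplifier rewrites vertex \<open>1\<close> to \<open>Suc 0\<close>, so its
    gain is supplied in both forms.\<close>
  note eval = gain_hard_graph_values gain_hard_graph_values(2)[unfolded One_nat_def] side_def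
  have half: "alg_prob {..<8::nat} 0 = 1 / 2" by simp
  have "?reach (Suc 0) {} {{}}"
    using no_improving_flip_at_half[OF fin_digraph_hard_graph loopfree_digraph_hard_graph, of "{}"]
    by (intro next_round[OF init]) (simp, unfold half verts_hard_graph, blast)
  then have "?reach 1 {} {{}}" by simp
  then have "?reach 1 {4} {{4}, {}}"
    by (rule flip_hard_graph[where i = 4]) (auto simp: eval)
  then have "?reach 1 {0, 4} {{0, 4}, {4}, {}}"
    by (rule flip_hard_graph[where i = 0]) (auto simp: eval)
  then have "?reach 1 {0, 1, 4} {{0, 1, 4}, {0, 4}, {4}, {}}"
    by (rule flip_hard_graph[where i = 1]) (auto simp: eval)
  then have "?reach 1 {0, 1, 4, 6} {{0, 1, 4, 6}, {0, 1, 4}, {0, 4}, {4}, {}}"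
    by (rule flip_hard_graph[where i = 6]) (auto simp: eval)
  then have "?reach 172 {0, 1, 4, 6} {{0, 1, 4, 6}, {0, 1, 4}, {0, 4}, {4}, {}}"
    by (rule alg_reach_stable) (simp_all only: alg_prob_8, auto intro: local_opt_early simp del: One_nat_def)
  \<comment> \<open>A chain reaction through the light arcs: removing 4 makes 5 improving, adding 5
    expels 6, and the loss of 6 admits 7. The cut value climbs 642, 660, 678, 679, 680.\<close>
  then have "?reach 172 {0, 1, 6} {{0, 1, 6}, {0, 1, 4, 6}, {0, 1, 4}, {0, 4}, {4}, {}}"
    by (rule flip_hard_graph[where i = 4]) (auto simp: eval)
  then have "?reach 172 {0, 1, 5, 6} {{0, 1, 5, 6}, {0, 1, 6}, {0, 1, 4, 6}, {0, 1, 4}, {0, 4}, {4}, {}}"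
    by (rule flip_hard_graph[where i = 5]) (auto simp: eval)
  then have "?reach 172 {0, 1, 5}
      {{0, 1, 5}, {0, 1, 5, 6}, {0, 1, 6}, {0, 1, 4, 6}, {0, 1, 4}, {0, 4}, {4}, {}}"
    by (rule flip_hard_graph[where i = 6]) (auto simp: eval)
  then have "?reach 172 {0, 1, 5, 7}
      {{0, 1, 5, 7}, {0, 1, 5}, {0, 1, 5, 6}, {0, 1, 6}, {0, 1, 4, 6}, {0, 1, 4}, {0, 4}, {4}, {}}"
    by (rule flip_hard_graph[where i = 7]) (auto simp: eval)
  then show ?thesis
    unfolding worst_sets_def by (rule alg_reach_stable) (simp_all only: alg_prob_8, auto intro: local_opt_late simp del: One_nat_def)
qed

section \<open>The approximation factor\<close>

lemma alg_returns_hard_graph_ge: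
  assumes "alg_returns {..<8} (dicut hard_graph) R"
  shows "R \<subseteq> {..<8} \<and> 680 \<le> dicut hard_graph R"
proof -
  from assms obtain k A E where reach: "alg_reach {..<8} (dicut hard_graph) k A E"
    and halt: "\<not> alg_prob {..<8::nat} k < 1"
    and R: "R \<in> E \<union> (\<lambda>S. {..<8} - S) ` E"
      "\<forall>S \<in> E \<union> (\<lambda>S. {..<8} - S) ` E. dicut hard_graph S \<le> dicut hard_graph R"
    unfolding alg_returns_def by blast
  from reach halt obtain j where j: "k = Suc j" "alg_prob {..<8::nat} j < 1"
      "local_opt {..<8} (dicut hard_graph) (alg_prob {..<8::nat} j) A"
    by (rule alg_reach_terminal)
  \<comment> \<open>Bias below 1 in round \<open>j\<close> but not in the next pins the final bias
    to 511/512.\<close>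
  have "real j < 256" "255 \<le> real j" using halt j(1,2) by (simp_all add: field_simps)
  then have "j = 255" by linarith
  with j(3) have "680 \<le> dicut hard_graph A"
    by (intro local_opt_hard_graph_ge) simp
  moreover have "A \<in> E" "E \<subseteq> Pow {..<8}"
    using alg_reach_sets[OF reach] by auto
  ultimately have "680 \<le> dicut hard_graph R" "R \<subseteq> {..<8}"
    using R by (force intro: order_trans, blast)
  then show ?thesis by blast
qed

lemma dicut_hard_graph_680: "dicut hard_graph {0, 1, 5, 7} = 680"
  by (simp add: dicut_hard_graph_value)

lemma alg_returns_hard_graph: "alg_returns {..<8} (dicut hard_graph) {0, 1, 5, 7}"
proof -
  have "dicut hard_graph S \<le> 680 \<and> dicut hard_graph ({..<8} - S) \<le> 680"
    if "S \<in> worst_sets" for S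
    using that unfolding worst_sets_def
    by (elim insertE emptyE) (simp_all add: dicut_hard_graph_value)
  then have "\<forall>S \<in> worst_sets \<union> (\<lambda>S. {..<8} - S) ` worst_sets.
      dicut hard_graph S \<le> dicut hard_graph {0, 1, 5, 7}"
    unfolding dicut_hard_graph_680 by blast
  moreover have "{0, 1, 5, 7} \<in> worst_sets" by (simp add: worst_sets_def)
  moreover have "\<not> alg_prob {..<8::nat} 256 < 1" by simp
  ultimately show ?thesis
    unfolding alg_returns_def using worst_execution by blast
qed

text \<open>The ratio is 680/1400. Returned sets lie in \<open>{..<8}\<close>, which gives the
  finiteness that \<open>Min\<close> needs.\<close>

lemma approximation_factor_hard_graph:
  "approximation_factor {..<8} (dicut hard_graph) = 17 / 35"
  unfolding approximation_factor_def Max_dicut_hard_graph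
proof (rule Min_eqI)
  let ?V = "{dicut hard_graph R / 1400 | R. alg_returns {..<8} (dicut hard_graph) R}"
  have "?V \<subseteq> (\<lambda>R. dicut hard_graph R / 1400) ` Pow {..<8}"
    using alg_returns_hard_graph_ge by blast
  then show "finite ?V" by (rule finite_subset) simp
  show "17 / 35 \<le> y" if "y \<in> ?V" for y
    using that alg_returns_hard_graph_ge by fastforce
  show "17 / 35 \<in> ?V"
    using alg_returns_hard_graph dicut_hard_graph_680 by (intro CollectI exI[of _ "{0, 1, 5, 7}"]) simp
qed

theorem theoremC1:
  shows "(\<exists>(X :: nat set) (f :: nat set \<Rightarrow> real).
            finite X \<and> (\<forall>S\<subseteq>X. 0 \<le> f S) \<and> submodular_on X f \<and>
            (\<exists>G :: (nat, nat) pre_digraph.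
               fin_digraph G \<and> loopfree_digraph G \<and> verts G = X \<and> f = dicut G) \<and>
            approximation_factor X f = 17 / 35)
         \<and> (17 / 35 :: real) < 0.486"
proof (intro conjI exI)
  show "\<forall>S\<subseteq>{..<8}. 0 \<le> dicut hard_graph S" by (simp add: dicut_def)
  show "submodular_on {..<8} (dicut hard_graph)"
    by (rule submodular_on_dicut[OF fin_digraph.finite_arcs[OF fin_digraph_hard_graph]])
qed (simp_all add: fin_digraph_hard_graph loopfree_digraph_hard_graph approximation_factor_hard_graph)

end
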